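(* Let $\mathbf{G}$ be a $2$-nilpotent group. Then $\mathbf{G}$ has an abelian group as a reduct if and only if the derived subgroup of $\mathbf{G}$ has odd exponent. Likewise, $\mathbf{G}$ has an abelian group as a polynomial reduct if and only if the derived subgroup of $\mathbf{G}$ has odd exponent.
   Context: Groups are viewed as algebras $(G,\cdot,{}^{-1},1)$. A group is $2$-nilpotent if it is nilpotent of class at most $2$, i.e. all commutators are central. A group has odd exponent if its exponent is finite and odd (possibly $1$). A term operation of an algebra is a finitary operation obtained by composing basic operations and projections; a polynomial operation is obtained by composing basic operations, projections and constants. A reduct (respectively polynomial reduct) of $\mathbf{G}$ is an algebra on the same universe $G$ all of whose basic operations are term operations (respectively polynomial operations) of $\mathbf{G}$. *)

theory Defs
  imports "HOL-Algebra.Generated_Groups"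
begin

text \<open>An operation of arity \<open>n\<close> is a function on lists, of which only the values on lists of
  length \<open>n\<close> over the universe matter. The basic operations form a set rather than an indexed
  family: repetitions and operation symbols are irrelevant for term operations and reducts.\<close>

type_synonym 'a operation = "'a list \<Rightarrow> 'a"

record 'a univ_algebra =
  universe :: "'a set"
  basic_operations :: "(nat \<times> 'a operation) set"

inductive composed_operation ::
    "(nat \<times> 'a operation) set \<Rightarrow> nat \<Rightarrow> 'a operation \<Rightarrow> bool" for F n
where
  projection: "i < n \<Longrightarrow> composed_operation F n (\<lambda>xs. xs ! i)"
| composition: "\<lbrakk>(m, f) \<in> F; length gs = m; \<And>g. g \<in> set gs \<Longrightarrow> composed_operation F n g\<rbrakk>
    \<Longrightarrow> composed_operation F n (\<lambda>xs. f (map (\<lambda>g. g xs) gs))"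

definition agrees_on :: "'a set \<Rightarrow> nat \<Rightarrow> 'a operation \<Rightarrow> 'a operation \<Rightarrow> bool" where
  "agrees_on A n f g \<longleftrightarrow> (\<forall>xs. length xs = n \<and> set xs \<subseteq> A \<longrightarrow> f xs = g xs)"

definition term_operation :: "'a univ_algebra \<Rightarrow> nat \<Rightarrow> 'a operation \<Rightarrow> bool" where
  "term_operation \<A> n f \<longleftrightarrow>
    (\<exists>t. composed_operation (basic_operations \<A>) n t \<and> agrees_on (universe \<A>) n f t)"

definition constant_operations :: "'a set \<Rightarrow> (nat \<times> 'a operation) set" where
  "constant_operations A = {(0, \<lambda>_. c) | c. c \<in> A}"

definition polynomial_operation :: "'a univ_algebra \<Rightarrow> nat \<Rightarrow> 'a operation \<Rightarrow> bool" where
  "polynomial_operation \<A> n f \<longleftrightarrow>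
    (\<exists>t. composed_operation (basic_operations \<A> \<union> constant_operations (universe \<A>)) n t
       \<and> agrees_on (universe \<A>) n f t)"

definition is_reduct :: "'a univ_algebra \<Rightarrow> 'a univ_algebra \<Rightarrow> bool" where
  "is_reduct \<B> \<A> \<longleftrightarrow> universe \<B> = universe \<A> \<and>
    (\<forall>(n, f) \<in> basic_operations \<B>. term_operation \<A> n f)"

definition is_polynomial_reduct :: "'a univ_algebra \<Rightarrow> 'a univ_algebra \<Rightarrow> bool" where
  "is_polynomial_reduct \<B> \<A> \<longleftrightarrow> universe \<B> = universe \<A> \<and>
    (\<forall>(n, f) \<in> basic_operations \<B>. polynomial_operation \<A> n f)"

definition group_algebra :: "('a, 'b) monoid_scheme \<Rightarrow> 'a univ_algebra" where
  "group_algebra G = \<lparr>universe = carrier G,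
     basic_operations =
       {(2, \<lambda>xs. xs ! 0 \<otimes>\<^bsub>G\<^esub> xs ! 1), (1, \<lambda>xs. inv\<^bsub>G\<^esub> (xs ! 0)), (0, \<lambda>_. \<one>\<^bsub>G\<^esub>)}\<rparr>"

definition group_center :: "('a, 'b) monoid_scheme \<Rightarrow> 'a set" where
  "group_center G = {z \<in> carrier G. \<forall>x \<in> carrier G. z \<otimes>\<^bsub>G\<^esub> x = x \<otimes>\<^bsub>G\<^esub> z}"

definition two_nilpotent :: "('a, 'b) monoid_scheme \<Rightarrow> bool" where
  "two_nilpotent G \<longleftrightarrow> derived_set G (carrier G) \<subseteq> group_center G"

definition derived_subgroup :: "('a, 'b) monoid_scheme \<Rightarrow> ('a, 'b) monoid_scheme" where
  "derived_subgroup G = G\<lparr>carrier := derived G (carrier G)\<rparr>"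

definition annihilating_exponent :: "('a, 'b) monoid_scheme \<Rightarrow> nat \<Rightarrow> bool" where
  "annihilating_exponent G n \<longleftrightarrow> n > 0 \<and> (\<forall>x \<in> carrier G. x [^]\<^bsub>G\<^esub> n = \<one>\<^bsub>G\<^esub>)"

definition finite_exponent :: "('a, 'b) monoid_scheme \<Rightarrow> bool" where
  "finite_exponent G \<longleftrightarrow> (\<exists>n. annihilating_exponent G n)"

text \<open>Only meaningful for groups of finite exponent.\<close>
definition group_exponent :: "('a, 'b) monoid_scheme \<Rightarrow> nat" where
  "group_exponent G = (LEAST n. annihilating_exponent G n)"

definition odd_exponent :: "('a, 'b) monoid_scheme \<Rightarrow> bool" where
  "odd_exponent G \<longleftrightarrow> finite_exponent G \<and> odd (group_exponent G)"

text \<open>In the next two definitions the record type \<open>'a monoid\<close> is no restriction: extra record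
  fields do not affect \<open>comm_group\<close> or \<open>group_algebra\<close>. The neutral element and the inverse of the
  abelian group are among its basic operations, so they must be term (polynomial) operations too.\<close>

definition has_abelian_group_reduct :: "('a, 'b) monoid_scheme \<Rightarrow> bool" where
  "has_abelian_group_reduct G \<longleftrightarrow>
    (\<exists>H :: 'a monoid. comm_group H \<and> is_reduct (group_algebra H) (group_algebra G))"

definition has_abelian_group_polynomial_reduct :: "('a, 'b) monoid_scheme \<Rightarrow> bool" where
  "has_abelian_group_polynomial_reduct G \<longleftrightarrow>
    (\<exists>H :: 'a monoid. comm_group H \<and> is_polynomial_reduct (group_algebra H) (group_algebra G))"

end

theory Submission
  imports Defs
begin

text \<open>
  Write \<open>[x, y] = x y x\<inverse> y\<inverse>\<close>, so that \<open>x y = y x [x, y]\<close>. In a 2-nilpotent group every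
  commutator is central, hence \<open>[x, y]\<close> is multiplicative in each argument, and the derived
  subgroup is abelian and generated by commutators. It therefore has odd exponent as soon as one
  fixed odd integer \<open>m\<close> satisfies \<open>[x, y]\<^sup>m = 1\<close> for all \<open>x, y\<close> (\<open>odd_exponent_derived\<close>).

  If the derived subgroup has exponent \<open>2 j + 1\<close>, the operation \<open>x y [x, y]\<^sup>j\<close> is an abelian group
  on the same universe, by a trick of Baer: \<open>j\<close> is half of \<open>-1\<close> modulo \<open>2 j + 1\<close>, so the factor
  \<open>[x, y]\<^sup>j\<close> removes the asymmetry of \<open>x y\<close>, and bilinearity of the commutator gives
  associativity. The neutral element and inverses are those of the group, so all basic operations
  of this abelian group are term operations (\<open>odd_exponent_imp_reduct\<close>).

  Conversely, since factors can be moved past each other at the cost of central commutators, each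
  binary polynomial has the form \<open>c x\<^sup>a y\<^sup>b \<phi>(x) \<psi>(y) [x, y]\<^sup>k\<close> with integers \<open>a, b, k\<close>, a constant
  \<open>c\<close> and central-valued functions \<open>\<phi>, \<psi>\<close> (\<open>polynomial_normal_form\<close>). For a commutative
  polynomial with a neutral element, \<open>a\<close> and \<open>b\<close> act as \<open>1\<close> inside commutators. Comparing
  \<open>p(x, y)\<close> with \<open>p(y, x)\<close> then yields \<open>[x, y]\<^bsup>2k+1\<^esup> = A(x) A(y)\<inverse>\<close> for a central-valued \<open>A\<close>, and
  \<open>y = 1\<close> shows that \<open>A\<close> is constant, so \<open>[x, y]\<^bsup>2k+1\<^esup> = 1\<close>
  (\<open>commutator_exponent_of_commutative_operation\<close>). Since \<open>2 k + 1\<close> is odd, it is nonzero, which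
  also yields that the exponent is finite. Term operations are polynomial operations, so the two
  kinds of reduct are settled together.
\<close>

section \<open>Commutators in 2-nilpotent groups\<close>

locale two_nilpotent_group = group G for G (structure) +
  assumes two_nilpotent: "two_nilpotent G"
begin

abbreviation Z where "Z \<equiv> group_center G"

definition commutator :: "'a \<Rightarrow> 'a \<Rightarrow> 'a" where
  "commutator x y = x \<otimes> y \<otimes> inv x \<otimes> inv y"

lemma center_closed: "z \<in> Z \<Longrightarrow> z \<in> carrier G"
  by (simp add: group_center_def)

lemma center_commute: "\<lbrakk>z \<in> Z; x \<in> carrier G\<rbrakk> \<Longrightarrow> x \<otimes> z = z \<otimes> x"
  by (simp add: group_center_def)

lemma subgroup_center: "subgroup Z G"
proof (rule subgroupI)
  show "Z \<noteq> {}" by (auto simp: group_center_def)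
next
  fix a assume a: "a \<in> Z"
  have "inv a \<otimes> x = x \<otimes> inv a" if "x \<in> carrier G" for x
  proof -
    have "inv a \<otimes> x = inv a \<otimes> (x \<otimes> a) \<otimes> inv a"
      using center_closed[OF a] that by (simp add: m_assoc)
    also have "\<dots> = inv a \<otimes> (a \<otimes> x) \<otimes> inv a"
      using center_commute[OF a that] by simp
    also have "\<dots> = x \<otimes> inv a"
      using center_closed[OF a] that by (simp add: m_assoc[symmetric])
    finally show ?thesis .
  qed
  then show "inv a \<in> Z" using center_closed[OF a] by (simp add: group_center_def)
next
  fix a b assume a: "a \<in> Z" and b: "b \<in> Z"
  have "a \<otimes> b \<otimes> x = x \<otimes> (a \<otimes> b)" if "x \<in> carrier G" for x
    using a b that by (metis center_closed center_commute m_assoc)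
  then show "a \<otimes> b \<in> Z" using center_closed[OF a] center_closed[OF b] by (simp add: group_center_def)
qed (auto simp: group_center_def)

text \<open>The closure of the center in the carrier becomes a simplification rule only once the center
  need no longer be unfolded: together with its definition the rule would loop.\<close>

declare center_closed [simp, intro]

lemma center_mult [simp, intro]: "\<lbrakk>x \<in> Z; y \<in> Z\<rbrakk> \<Longrightarrow> x \<otimes> y \<in> Z"
  and center_inv [simp, intro]: "x \<in> Z \<Longrightarrow> inv x \<in> Z"
  and center_one [simp, intro]: "\<one> \<in> Z"
  using subgroup_center by (auto simp: subgroup_def)

lemma center_int_pow [simp, intro]: "x \<in> Z \<Longrightarrow> x [^] (k::int) \<in> Z"
  by (rule subgroup_int_pow_closed[OF subgroup_center])

lemma center_nat_pow [simp, intro]: "x \<in> Z \<Longrightarrow> x [^] (k::nat) \<in> Z"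
  by (metis center_int_pow int_pow_int)

lemma center_comm: "\<lbrakk>x \<in> Z; y \<in> Z\<rbrakk> \<Longrightarrow> x \<otimes> y = y \<otimes> x"
  by (simp add: center_commute)

lemma center_left_comm: "\<lbrakk>x \<in> Z; y \<in> Z; u \<in> carrier G\<rbrakk> \<Longrightarrow> x \<otimes> (y \<otimes> u) = y \<otimes> (x \<otimes> u)"
  by (simp add: m_assoc[symmetric] center_comm[of x y])

lemmas center_ac = m_assoc center_comm center_left_comm

lemma center_int_pow_distrib:
  "\<lbrakk>x \<in> Z; y \<in> Z\<rbrakk> \<Longrightarrow> (x \<otimes> y) [^] (k::int) = x [^] k \<otimes> y [^] k"
  by (rule int_pow_mult_distrib) (auto simp: center_comm)

lemma center_inv_mult: "\<lbrakk>x \<in> Z; y \<in> Z\<rbrakk> \<Longrightarrow> inv (x \<otimes> y) = inv x \<otimes> inv y"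
  by (simp add: inv_mult_group center_comm)

lemma factor_center:
  "\<lbrakk>x \<in> carrier G; y \<in> carrier G; w \<in> Z; v \<in> Z\<rbrakk>
    \<Longrightarrow> (x \<otimes> w) \<otimes> (y \<otimes> v) = (x \<otimes> y) \<otimes> (w \<otimes> v)"
  by (metis center_closed center_commute m_assoc m_closed)

lemma commutator_center [simp, intro]:
  "\<lbrakk>x \<in> carrier G; y \<in> carrier G\<rbrakk> \<Longrightarrow> commutator x y \<in> Z"
  using two_nilpotent unfolding two_nilpotent_def commutator_def by blast

lemma commutator_closed [simp, intro]:
  "\<lbrakk>x \<in> carrier G; y \<in> carrier G\<rbrakk> \<Longrightarrow> commutator x y \<in> carrier G"
  by blast

lemma swap_commutator: "\<lbrakk>x \<in> carrier G; y \<in> carrier G\<rbrakk> \<Longrightarrow> x \<otimes> y = y \<otimes> x \<otimes> commutator x y"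
proof -
  assume x: "x \<in> carrier G" and y: "y \<in> carrier G"
  have "commutator x y \<otimes> (y \<otimes> x) = x \<otimes> y"
    using x y by (simp add: commutator_def m_assoc flip: inv_mult_group)
  then show ?thesis
    using x y center_commute[OF commutator_center[OF x y], of "y \<otimes> x"] by simp
qed

lemma commutator_unique:
  "\<lbrakk>x \<in> carrier G; y \<in> carrier G; d \<in> carrier G; x \<otimes> y = y \<otimes> x \<otimes> d\<rbrakk> \<Longrightarrow> commutator x y = d"
  using swap_commutator[of x y] by (metis commutator_closed Units_eq Units_l_cancel m_closed)

lemma commutator_inverse:
  assumes "x \<in> carrier G" "y \<in> carrier G"
  shows "commutator y x = inv (commutator x y)"
proof (rule commutator_unique)
  have "x \<otimes> y \<otimes> inv (commutator x y) = y \<otimes> x \<otimes> commutator x y \<otimes> inv (commutator x y)"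
    using swap_commutator[of x y] assms by simp
  also have "\<dots> = y \<otimes> x" using assms by (simp add: m_assoc)
  finally show "y \<otimes> x = x \<otimes> y \<otimes> inv (commutator x y)" by simp
qed (use assms in auto)

text \<open>Moving \<open>z\<close> leftwards through \<open>x \<otimes> y\<close> produces one central commutator for each factor.\<close>

lemma commutator_mult_left:
  assumes x: "x \<in> carrier G" and y: "y \<in> carrier G" and z: "z \<in> carrier G"
  shows "commutator (x \<otimes> y) z = commutator x z \<otimes> commutator y z"
proof (rule commutator_unique)
  have "x \<otimes> y \<otimes> z = x \<otimes> (z \<otimes> y \<otimes> commutator y z)"
    using x y z swap_commutator[of y z] by (simp add: m_assoc)
  also have "\<dots> = (x \<otimes> z) \<otimes> y \<otimes> commutator y z" using x y z by (simp add: m_assoc)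
  also have "\<dots> = (z \<otimes> x \<otimes> commutator x z) \<otimes> (y \<otimes> commutator y z)"
    using x y z swap_commutator[of x z] by (simp add: m_assoc)
  also have "\<dots> = z \<otimes> (x \<otimes> y) \<otimes> (commutator x z \<otimes> commutator y z)"
    using x y z by (subst factor_center) (auto simp: m_assoc)
  finally show "x \<otimes> y \<otimes> z = z \<otimes> (x \<otimes> y) \<otimes> (commutator x z \<otimes> commutator y z)" .
qed (use assms in auto)

lemma commutator_mult_right:
  assumes "x \<in> carrier G" "y \<in> carrier G" "z \<in> carrier G"
  shows "commutator z (x \<otimes> y) = commutator z x \<otimes> commutator z y"
  using assms commutator_mult_left[of x y z]
  by (simp add: commutator_inverse[of _ z] center_inv_mult)

lemma commutator_int_pow_left:
  assumes "x \<in> carrier G" "y \<in> carrier G"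
  shows "commutator (x [^] (k::int)) y = commutator x y [^] k"
  by (rule hom_int_pow[OF _ _ is_group is_group])
     (use assms in \<open>auto simp: hom_def commutator_mult_left\<close>)

lemma commutator_int_pow_right:
  assumes "x \<in> carrier G" "y \<in> carrier G"
  shows "commutator y (x [^] (k::int)) = commutator y x [^] k"
  by (rule hom_int_pow[OF _ _ is_group is_group])
     (use assms in \<open>auto simp: hom_def commutator_mult_right\<close>)

lemma commutator_with_center:
  assumes "z \<in> Z" "x \<in> carrier G"
  shows "commutator z x = \<one>" "commutator x z = \<one>"
  by (rule commutator_unique; use assms in \<open>simp add: center_commute[OF assms]\<close>)+

section \<open>Normal form of binary polynomials\<close>

text \<open>The central part of a binary polynomial. The constants of a polynomial enter commutators such
  as \<open>[x, d]\<close>, which are central and depend on one variable only; all that matters about them is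
  absorbed by \<open>\<phi>\<close> and \<open>\<psi>\<close>, which may be arbitrary. The exponent \<open>k\<close> records the only
  interaction between the two variables.\<close>

definition central_mixed :: "int \<Rightarrow> ('a \<Rightarrow> 'a \<Rightarrow> 'a) \<Rightarrow> bool" where
  "central_mixed k w \<longleftrightarrow> (\<exists>\<phi> \<psi>. (\<forall>x \<in> carrier G. \<phi> x \<in> Z) \<and> (\<forall>y \<in> carrier G. \<psi> y \<in> Z) \<and>
     (\<forall>x \<in> carrier G. \<forall>y \<in> carrier G. w x y = \<phi> x \<otimes> \<psi> y \<otimes> commutator x y [^] k))"

lemma central_mixedI:
  assumes "\<And>x. x \<in> carrier G \<Longrightarrow> \<phi> x \<in> Z" "\<And>y. y \<in> carrier G \<Longrightarrow> \<psi> y \<in> Z"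
    "\<And>x y. \<lbrakk>x \<in> carrier G; y \<in> carrier G\<rbrakk> \<Longrightarrow> w x y = \<phi> x \<otimes> \<psi> y \<otimes> commutator x y [^] k"
  shows "central_mixed k w"
  unfolding central_mixed_def by (intro exI[of _ \<phi>] exI[of _ \<psi>]) (auto simp: assms)

lemma central_mixed_center: "\<lbrakk>central_mixed k w; x \<in> carrier G; y \<in> carrier G\<rbrakk> \<Longrightarrow> w x y \<in> Z"
  unfolding central_mixed_def by auto

lemma central_mixed_left: "(\<And>x. x \<in> carrier G \<Longrightarrow> \<phi> x \<in> Z) \<Longrightarrow> central_mixed 0 (\<lambda>x y. \<phi> x)"
  by (rule central_mixedI[of \<phi> "\<lambda>_. \<one>"]) auto

lemma central_mixed_right: "(\<And>y. y \<in> carrier G \<Longrightarrow> \<psi> y \<in> Z) \<Longrightarrow> central_mixed 0 (\<lambda>x y. \<psi> y)"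
  by (rule central_mixedI[of "\<lambda>_. \<one>" \<psi>]) auto

lemma central_mixed_mult:
  assumes "central_mixed k w" "central_mixed l v"
  shows "central_mixed (k + l) (\<lambda>x y. w x y \<otimes> v x y)"
proof -
  obtain \<phi> \<psi> where 1: "\<And>x. x \<in> carrier G \<Longrightarrow> \<phi> x \<in> Z" "\<And>y. y \<in> carrier G \<Longrightarrow> \<psi> y \<in> Z"
    "\<And>x y. \<lbrakk>x \<in> carrier G; y \<in> carrier G\<rbrakk> \<Longrightarrow> w x y = \<phi> x \<otimes> \<psi> y \<otimes> commutator x y [^] k"
    using assms(1) unfolding central_mixed_def by blast
  obtain \<phi>' \<psi>' where 2: "\<And>x. x \<in> carrier G \<Longrightarrow> \<phi>' x \<in> Z" "\<And>y. y \<in> carrier G \<Longrightarrow> \<psi>' y \<in> Z"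
    "\<And>x y. \<lbrakk>x \<in> carrier G; y \<in> carrier G\<rbrakk> \<Longrightarrow> v x y = \<phi>' x \<otimes> \<psi>' y \<otimes> commutator x y [^] l"
    using assms(2) unfolding central_mixed_def by blast
  show ?thesis
    by (rule central_mixedI[of "\<lambda>x. \<phi> x \<otimes> \<phi>' x" "\<lambda>y. \<psi> y \<otimes> \<psi>' y"])
       (simp_all add: 1 2 center_ac flip: int_pow_mult)
qed

lemma central_mixed_inv:
  assumes "central_mixed k w"
  shows "central_mixed (- k) (\<lambda>x y. inv (w x y))"
proof -
  obtain \<phi> \<psi> where 1: "\<And>x. x \<in> carrier G \<Longrightarrow> \<phi> x \<in> Z" "\<And>y. y \<in> carrier G \<Longrightarrow> \<psi> y \<in> Z"
    "\<And>x y. \<lbrakk>x \<in> carrier G; y \<in> carrier G\<rbrakk> \<Longrightarrow> w x y = \<phi> x \<otimes> \<psi> y \<otimes> commutator x y [^] k"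
    using assms(1) unfolding central_mixed_def by blast
  show ?thesis
    by (rule central_mixedI[of "\<lambda>x. inv (\<phi> x)" "\<lambda>y. inv (\<psi> y)"])
       (simp_all add: 1 center_inv_mult int_pow_neg)
qed

lemma central_mixed_commutator:
  "central_mixed (- (b * a)) (\<lambda>x y. commutator (y [^] b) (x [^] a))"
proof (rule central_mixedI[of "\<lambda>_. \<one>" "\<lambda>_. \<one>"])
  fix x y assume [simp]: "x \<in> carrier G" "y \<in> carrier G"
  show "commutator (y [^] b) (x [^] a) = \<one> \<otimes> \<one> \<otimes> commutator x y [^] (- (b * a))"
    by (simp add: commutator_int_pow_left commutator_int_pow_right int_pow_pow
        commutator_inverse[of x y] int_pow_inv int_pow_neg mult.commute)
qed auto

definition normal_form :: "('a \<Rightarrow> 'a \<Rightarrow> 'a) \<Rightarrow> bool" where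
  "normal_form f \<longleftrightarrow> (\<exists>c \<in> carrier G. \<exists>(a::int) (b::int) k w. central_mixed k w \<and>
     (\<forall>x \<in> carrier G. \<forall>y \<in> carrier G. f x y = c \<otimes> x [^] a \<otimes> y [^] b \<otimes> w x y))"

lemma normal_formI:
  assumes "c \<in> carrier G" "central_mixed k w"
    "\<And>x y. \<lbrakk>x \<in> carrier G; y \<in> carrier G\<rbrakk> \<Longrightarrow> f x y = c \<otimes> x [^] (a::int) \<otimes> y [^] (b::int) \<otimes> w x y"
  shows "normal_form f"
  using assms unfolding normal_form_def by blast

lemma normal_formE:
  assumes "normal_form f"
  obtains c a b k w where "c \<in> carrier G" "central_mixed k w"
    "\<And>x y. \<lbrakk>x \<in> carrier G; y \<in> carrier G\<rbrakk> \<Longrightarrow> f x y = c \<otimes> x [^] (a::int) \<otimes> y [^] (b::int) \<otimes> w x y"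
  using assms unfolding normal_form_def by blast

lemma normal_form_const: "c \<in> carrier G \<Longrightarrow> normal_form (\<lambda>x y. c)"
  by (rule normal_formI[OF _ central_mixed_left[of "\<lambda>_. \<one>"], where a = 0 and b = 0]) auto

lemma normal_form_fst: "normal_form (\<lambda>x y. x)"
  by (rule normal_formI[OF _ central_mixed_left[of "\<lambda>_. \<one>"], where a = 1 and b = 0]) auto

lemma normal_form_snd: "normal_form (\<lambda>x y. y)"
  by (rule normal_formI[OF _ central_mixed_left[of "\<lambda>_. \<one>"], where a = 0 and b = 1]) auto

text \<open>Collecting equal factors of two words: \<open>d\<close> has to pass \<open>X\<close> and \<open>Y\<close>, and \<open>U\<close> has to pass
  \<open>Y\<close>; each exchange leaves a commutator.\<close>

lemma normal_form_collect:
  assumes [simp]: "c \<in> carrier G" "X \<in> carrier G" "Y \<in> carrier G"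
    "d \<in> carrier G" "U \<in> carrier G" "V \<in> carrier G"
  shows "(c \<otimes> X \<otimes> Y) \<otimes> (d \<otimes> U \<otimes> V) = (c \<otimes> d) \<otimes> (X \<otimes> U) \<otimes> (Y \<otimes> V) \<otimes>
    (commutator X d \<otimes> commutator Y d \<otimes> commutator Y U)"
proof -
  define k where "k = commutator X d"
  define l where "l = commutator Y d"
  define m where "m = commutator Y U"
  have [simp]: "k \<in> Z" "l \<in> Z" "m \<in> Z" by (auto simp: k_def l_def m_def)
  have "(c \<otimes> X \<otimes> Y) \<otimes> (d \<otimes> U \<otimes> V) = c \<otimes> (X \<otimes> (Y \<otimes> d) \<otimes> (U \<otimes> V))"
    by (simp add: m_assoc)
  also have "X \<otimes> (Y \<otimes> d) = X \<otimes> d \<otimes> Y \<otimes> l"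
    by (subst swap_commutator[of Y d]) (simp_all add: l_def m_assoc)
  also have "X \<otimes> d = d \<otimes> X \<otimes> k"
    unfolding k_def by (rule swap_commutator) auto
  also have "d \<otimes> X \<otimes> k \<otimes> Y \<otimes> l = d \<otimes> X \<otimes> Y \<otimes> (k \<otimes> l)"
    using factor_center[of "d \<otimes> X" Y k l] by (simp add: m_assoc)
  also have "d \<otimes> X \<otimes> Y \<otimes> (k \<otimes> l) \<otimes> (U \<otimes> V) = d \<otimes> X \<otimes> (Y \<otimes> U) \<otimes> V \<otimes> (k \<otimes> l)"
    using factor_center[of "d \<otimes> X \<otimes> Y" "U \<otimes> V" "k \<otimes> l" \<one>] by (simp add: m_assoc)
  also have "Y \<otimes> U = U \<otimes> Y \<otimes> m"
    unfolding m_def by (rule swap_commutator) auto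
  also have "d \<otimes> X \<otimes> (U \<otimes> Y \<otimes> m) \<otimes> V = d \<otimes> (X \<otimes> U) \<otimes> (Y \<otimes> V) \<otimes> m"
    using factor_center[of "d \<otimes> X \<otimes> U \<otimes> Y" V m \<one>] by (simp add: m_assoc)
  also have "c \<otimes> (d \<otimes> (X \<otimes> U) \<otimes> (Y \<otimes> V) \<otimes> m \<otimes> (k \<otimes> l)) =
      (c \<otimes> d) \<otimes> (X \<otimes> U) \<otimes> (Y \<otimes> V) \<otimes> (k \<otimes> l \<otimes> m)"
    by (simp add: m_assoc center_comm[of m "k \<otimes> l"])
  finally show ?thesis by (simp add: k_def l_def m_def)
qed

text \<open>The commutators left by collecting are of the admitted kind: two of them involve a constant
  and hence a single variable, and \<open>[y\<^sup>b, x\<^sup>a]\<close> is a power of \<open>[x, y]\<close>.\<close>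

lemma normal_form_mult:
  assumes "normal_form f" "normal_form g"
  shows "normal_form (\<lambda>x y. f x y \<otimes> g x y)"
proof -
  obtain c a b k w where c [simp]: "c \<in> carrier G" and w: "central_mixed k w"
    and f: "\<And>x y. \<lbrakk>x \<in> carrier G; y \<in> carrier G\<rbrakk> \<Longrightarrow> f x y = c \<otimes> x [^] (a::int) \<otimes> y [^] (b::int) \<otimes> w x y"
    by (rule normal_formE[OF assms(1)], rule that)
  obtain c' a' b' k' w' where c' [simp]: "c' \<in> carrier G" and w': "central_mixed k' w'"
    and g: "\<And>x y. \<lbrakk>x \<in> carrier G; y \<in> carrier G\<rbrakk> \<Longrightarrow> g x y = c' \<otimes> x [^] (a'::int) \<otimes> y [^] (b'::int) \<otimes> w' x y"
    by (rule normal_formE[OF assms(2)], rule that)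
  have "central_mixed 0 (\<lambda>x y. commutator (x [^] a) c')" "central_mixed 0 (\<lambda>x y. commutator (y [^] b) c')"
    by (auto intro!: central_mixed_left central_mixed_right)
  note r = central_mixed_mult[OF central_mixed_mult[OF central_mixed_mult[OF this] central_mixed_commutator] central_mixed_mult[OF w w']]
  show ?thesis
  proof (rule normal_formI[OF _ r])
    fix x y assume [simp]: "x \<in> carrier G" "y \<in> carrier G"
    have [simp]: "w x y \<in> Z" "w' x y \<in> Z" using w w' by (auto intro: central_mixed_center)
    let ?u = "commutator (x [^] a) c' \<otimes> commutator (y [^] b) c' \<otimes> commutator (y [^] b) (x [^] a')"
    have "f x y \<otimes> g x y =
        (c \<otimes> x [^] a \<otimes> y [^] b) \<otimes> (c' \<otimes> x [^] a' \<otimes> y [^] b') \<otimes> (w x y \<otimes> w' x y)"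
      unfolding f[OF \<open>x \<in> carrier G\<close> \<open>y \<in> carrier G\<close>] g[OF \<open>x \<in> carrier G\<close> \<open>y \<in> carrier G\<close>]
      by (rule factor_center) auto
    also have "(c \<otimes> x [^] a \<otimes> y [^] b) \<otimes> (c' \<otimes> x [^] a' \<otimes> y [^] b') =
        c \<otimes> c' \<otimes> (x [^] a \<otimes> x [^] a') \<otimes> (y [^] b \<otimes> y [^] b') \<otimes> ?u"
      by (rule normal_form_collect) auto
    also have "\<dots> = c \<otimes> c' \<otimes> x [^] (a + a') \<otimes> y [^] (b + b') \<otimes> ?u"
      by (simp only: int_pow_mult \<open>x \<in> carrier G\<close> \<open>y \<in> carrier G\<close>)
    also have "\<dots> \<otimes> (w x y \<otimes> w' x y) =
        c \<otimes> c' \<otimes> x [^] (a + a') \<otimes> y [^] (b + b') \<otimes> (?u \<otimes> (w x y \<otimes> w' x y))"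
      by (rule m_assoc) auto
    finally show "f x y \<otimes> g x y =
        c \<otimes> c' \<otimes> x [^] (a + a') \<otimes> y [^] (b + b') \<otimes> (?u \<otimes> (w x y \<otimes> w' x y))" .
  qed simp
qed

text \<open>Collecting \<open>c x\<^sup>a y\<^sup>b\<close> with its candidate inverse \<open>c\<inverse> x\<^bsup>-a\<^esup> y\<^bsup>-b\<^esup>\<close>, all exponents cancel
  and only a central factor remains to be inverted.\<close>

lemma normal_form_inv:
  assumes "normal_form f"
  shows "normal_form (\<lambda>x y. inv (f x y))"
proof -
  obtain c a b k w where c [simp]: "c \<in> carrier G" and w: "central_mixed k w"
    and f: "\<And>x y. \<lbrakk>x \<in> carrier G; y \<in> carrier G\<rbrakk> \<Longrightarrow> f x y = c \<otimes> x [^] (a::int) \<otimes> y [^] (b::int) \<otimes> w x y"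
    by (rule normal_formE[OF assms(1)], rule that)
  have "central_mixed 0 (\<lambda>x y. commutator (x [^] a) (inv c))" "central_mixed 0 (\<lambda>x y. commutator (y [^] b) (inv c))"
    by (auto intro!: central_mixed_left central_mixed_right)
  note r = central_mixed_inv[OF central_mixed_mult[OF central_mixed_mult[OF central_mixed_mult[OF this] central_mixed_commutator] w]]
  show ?thesis
  proof (rule normal_formI[OF _ r])
    fix x y assume [simp]: "x \<in> carrier G" "y \<in> carrier G"
    define u where "u = commutator (x [^] a) (inv c) \<otimes> commutator (y [^] b) (inv c) \<otimes>
        commutator (y [^] b) (x [^] (- a))"
    define g where "g = inv c \<otimes> x [^] (- a) \<otimes> y [^] (- b)"
    have [simp]: "w x y \<in> Z" using w by (auto intro: central_mixed_center)
    have [simp]: "u \<in> Z" "g \<in> carrier G" "f x y \<in> carrier G" by (auto simp: u_def g_def f)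
    have "f x y \<otimes> g = (c \<otimes> x [^] a \<otimes> y [^] b) \<otimes> g \<otimes> w x y"
      using factor_center[of "c \<otimes> x [^] a \<otimes> y [^] b" g "w x y" \<one>] by (simp add: f)
    also have "\<dots> = u \<otimes> w x y"
      unfolding g_def by (subst normal_form_collect) (simp_all add: u_def int_pow_neg)
    finally have "g = inv (f x y) \<otimes> (u \<otimes> w x y)" by (subst inv_solve_left) auto
    then have "inv (f x y) = g \<otimes> inv (u \<otimes> w x y)" by (subst inv_solve_right) auto
    then show "inv (f x y) = inv c \<otimes> x [^] (- a) \<otimes> y [^] (- b) \<otimes>
       inv (commutator (x [^] a) (inv c) \<otimes> commutator (y [^] b) (inv c) \<otimes>
        commutator (y [^] b) (x [^] (- a)) \<otimes> w x y)"
      by (simp add: u_def g_def)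
  qed simp
qed

lemma polynomial_normal_form:
  assumes "composed_operation (basic_operations (group_algebra G) \<union> constant_operations (carrier G)) 2 t"
  shows "normal_form (\<lambda>x y. t [x, y])"
  using assms
proof induction
  case (projection i)
  then have "i = 0 \<or> i = 1" by auto
  then show ?case by (auto intro: normal_form_fst normal_form_snd)
next
  case (composition m f gs)
  from composition.hyps(1) consider (mult) "m = 2" "f = (\<lambda>xs. xs ! 0 \<otimes> xs ! 1)"
    | (inv) "m = 1" "f = (\<lambda>xs. inv (xs ! 0))"
    | (const) c where "c \<in> carrier G" "f = (\<lambda>_. c)"
    by (auto simp: group_algebra_def constant_operations_def)
  then show ?case
  proof cases
    case mult
    then have "gs ! 0 \<in> set gs" "gs ! 1 \<in> set gs" using composition.hyps(2) by auto
    from this[THEN composition.IH] mult composition.hyps(2) show ?thesis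
      by (simp add: normal_form_mult)
  next
    case inv
    then have "gs ! 0 \<in> set gs" using composition.hyps(2) by auto
    from this[THEN composition.IH] inv composition.hyps(2) show ?thesis
      by (simp add: normal_form_inv)
  next
    case const
    then show ?thesis by (simp add: normal_form_const)
  qed
qed

section \<open>Abelian polynomial reducts force an odd exponent\<close>

text \<open>The neutral law gives \<open>[x\<^sup>a, z] = [x, z]\<close>, and commutativity makes \<open>y\<^sup>a\<close> and \<open>y\<^sup>b\<close>
  agree modulo the center. Hence \<open>p x y\<close> and \<open>p y x\<close> differ by central factors only, and their
  equality becomes an equation for a power of \<open>[x, y]\<close>. The neutral element \<open>e\<close> may differ from
  the neutral element of the group.\<close>

lemma commutator_exponent_of_commutative_operation:
  assumes p: "normal_form p" and e: "e \<in> carrier G"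
    and neutral: "\<And>x. x \<in> carrier G \<Longrightarrow> p x e = x"
    and comm: "\<And>x y. \<lbrakk>x \<in> carrier G; y \<in> carrier G\<rbrakk> \<Longrightarrow> p x y = p y x"
  shows "\<exists>m::int. odd m \<and> (\<forall>x \<in> carrier G. \<forall>y \<in> carrier G. commutator x y [^] m = \<one>)"
proof -
  obtain c a b k w where c [simp]: "c \<in> carrier G" and w: "central_mixed k w"
    and p: "\<And>x y. \<lbrakk>x \<in> carrier G; y \<in> carrier G\<rbrakk> \<Longrightarrow> p x y = c \<otimes> x [^] (a::int) \<otimes> y [^] (b::int) \<otimes> w x y"
    by (rule normal_formE[OF p], rule that)
  obtain \<phi> \<psi> where \<phi> [simp]: "\<And>x. x \<in> carrier G \<Longrightarrow> \<phi> x \<in> Z"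
    and \<psi> [simp]: "\<And>y. y \<in> carrier G \<Longrightarrow> \<psi> y \<in> Z"
    and w_eq: "\<And>x y. \<lbrakk>x \<in> carrier G; y \<in> carrier G\<rbrakk> \<Longrightarrow> w x y = \<phi> x \<otimes> \<psi> y \<otimes> commutator x y [^] k"
    using w unfolding central_mixed_def by blast
  have wZ [simp]: "\<And>x y. \<lbrakk>x \<in> carrier G; y \<in> carrier G\<rbrakk> \<Longrightarrow> w x y \<in> Z"
    by (rule central_mixed_center[OF w])
  \<comment> \<open>Modulo the center, \<open>x = p x e\<close> is \<open>c x\<^sup>a e\<^sup>b\<close>; taking commutators with \<open>z\<close> and comparing with
    the case \<open>x = \<one>\<close> removes the contribution of \<open>c\<close> and \<open>e\<close>.\<close>
  have pow_a: "commutator x z [^] a = commutator x z"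
    if x [simp]: "x \<in> carrier G" and z [simp]: "z \<in> carrier G" for x z
  proof -
    define d where "d = commutator c z \<otimes> commutator e z [^] b"
    have d [simp]: "d \<in> Z" using e by (simp add: d_def)
    have *: "commutator v z = commutator v z [^] a \<otimes> d" if v [simp]: "v \<in> carrier G" for v
    proof -
      have "commutator v z = commutator (c \<otimes> v [^] a \<otimes> e [^] b \<otimes> w v e) z"
        using neutral[OF v] p[OF v e] by simp
      also have "\<dots> = commutator v z [^] a \<otimes> d"
        using e by (simp add: commutator_mult_left commutator_int_pow_left commutator_with_center
            d_def center_ac)
      finally show ?thesis .
    qed
    from *[of \<one>] have "d = \<one>" by (simp add: commutator_with_center)
    with *[of x] show ?thesis by simp
  qed
  \<comment> \<open>Commutativity at the pair \<open>\<one>\<close>, \<open>y\<close> makes \<open>y\<^sup>a\<close> and \<open>y\<^sup>b\<close> agree up to a central factor.\<close>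
  define \<gamma> where "\<gamma> y = w y \<one> \<otimes> inv (w \<one> y)" for y
  have \<gamma> [simp]: "\<gamma> y \<in> Z" if "y \<in> carrier G" for y using that by (simp add: \<gamma>_def)
  have pow_b: "y [^] b = y [^] a \<otimes> \<gamma> y" if [simp]: "y \<in> carrier G" for y
  proof -
    have "c \<otimes> (y [^] b \<otimes> w \<one> y) = c \<otimes> (y [^] a \<otimes> w y \<one>)"
      using comm[of \<one> y] by (simp add: p m_assoc)
    then have "y [^] b \<otimes> w \<one> y = y [^] a \<otimes> w y \<one>" by simp
    then have "y [^] b = (y [^] a \<otimes> w y \<one>) \<otimes> inv (w \<one> y)"
      by (subst inv_solve_right) auto
    then show ?thesis by (simp add: \<gamma>_def m_assoc)
  qed
  \<comment> \<open>\<open>A\<close> gathers all one-variable factors that occur when \<open>p x y = p y x\<close> is solved for the power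
    of \<open>[x, y]\<close>.\<close>
  define A where "A x = \<gamma> x \<otimes> \<psi> x \<otimes> inv (\<phi> x)" for x
  have A [simp]: "A x \<in> Z" if "x \<in> carrier G" for x using that by (simp add: A_def)
  have main: "commutator x y [^] (2 * k + 1) = A x \<otimes> inv (A y)"
    if x [simp]: "x \<in> carrier G" and y [simp]: "y \<in> carrier G" for x y
  proof -
    define D where "D = commutator x y"
    have D [simp]: "D \<in> Z" by (simp add: D_def)
    have "commutator (x [^] a) (y [^] a) = D"
      by (simp add: commutator_int_pow_left commutator_int_pow_right pow_a D_def)
    then have XY: "x [^] a \<otimes> y [^] a = y [^] a \<otimes> x [^] a \<otimes> D"
      using swap_commutator[of "x [^] a" "y [^] a"] by simp
    have "p x y = c \<otimes> (x [^] a \<otimes> y [^] a) \<otimes> (\<gamma> y \<otimes> w x y)"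
      by (simp add: p pow_b m_assoc)
    moreover have "p y x = c \<otimes> (y [^] a \<otimes> x [^] a) \<otimes> (\<gamma> x \<otimes> w y x)"
      by (simp add: p pow_b m_assoc)
    ultimately have "(c \<otimes> y [^] a \<otimes> x [^] a) \<otimes> (D \<otimes> (\<gamma> y \<otimes> w x y)) =
        (c \<otimes> y [^] a \<otimes> x [^] a) \<otimes> (\<gamma> x \<otimes> w y x)"
      using comm[OF x y] by (simp add: XY m_assoc)
    then have 1: "D \<otimes> (\<gamma> y \<otimes> w x y) = \<gamma> x \<otimes> w y x" by simp
    have 2: "w x y = \<phi> x \<otimes> \<psi> y \<otimes> D [^] k" by (simp add: w_eq D_def)
    have 3: "w y x = \<phi> y \<otimes> \<psi> x \<otimes> inv (D [^] k)"
      by (simp add: w_eq D_def commutator_inverse[of x y] int_pow_inv)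
    have "D [^] (2 * k + 1) \<otimes> (\<gamma> y \<otimes> \<psi> y \<otimes> \<phi> x) = (D [^] k \<otimes> D [^] k \<otimes> D) \<otimes> (\<gamma> y \<otimes> \<psi> y \<otimes> \<phi> x)"
      using int_pow_mult[of D "2 * k" 1] int_pow_mult[of D k k] by simp
    also have "\<dots> = (D \<otimes> (\<gamma> y \<otimes> w x y)) \<otimes> D [^] k"
      by (simp add: 2 center_ac)
    also have "\<dots> = (\<gamma> x \<otimes> \<psi> x \<otimes> \<phi> y) \<otimes> (inv (D [^] k) \<otimes> D [^] k)"
      unfolding 1 3 by (simp add: center_ac del: l_inv r_inv)
    also have "\<dots> = \<gamma> x \<otimes> \<psi> x \<otimes> \<phi> y" by simp
    finally have "D [^] (2 * k + 1) = (\<gamma> x \<otimes> \<psi> x \<otimes> \<phi> y) \<otimes> inv (\<gamma> y \<otimes> \<psi> y \<otimes> \<phi> x)"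
      by (subst inv_solve_right) auto
    also have "\<dots> = A x \<otimes> inv (A y)"
      by (simp add: A_def center_inv_mult center_ac)
    finally show ?thesis by (simp add: D_def)
  qed
  have const: "A x = A \<one>" if "x \<in> carrier G" for x
  proof -
    have "\<one> = A x \<otimes> inv (A \<one>)"
      using main[OF that one_closed] that by (simp add: commutator_with_center)
    then show ?thesis using that by (metis A center_closed inv_closed inv_equality inv_inv one_closed)
  qed
  have "commutator x y [^] (2 * k + 1) = \<one>" if "x \<in> carrier G" "y \<in> carrier G" for x y
    using main[OF that] const[OF that(1)] const[OF that(2)] by simp
  then show ?thesis by (intro exI[of _ "2 * k + 1"]) auto
qed

lemma annihilating_exponent_derived_iff:
  "annihilating_exponent (derived_subgroup G) n \<longleftrightarrow>
    n > 0 \<and> (\<forall>z \<in> derived G (carrier G). z [^] n = \<one>)"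
  by (simp add: annihilating_exponent_def derived_subgroup_def nat_pow_consistent[symmetric])

lemma derived_closed: "z \<in> derived G (carrier G) \<Longrightarrow> z \<in> carrier G"
  using derived_in_carrier[of "carrier G"] by blast

text \<open>The central elements killed by \<open>m\<close> form a subgroup, so it suffices that it contains the
  commutators. The exponent divides every annihilating number, in particular the odd number
  \<open>\<bar>m\<bar>\<close>, and hence is odd.\<close>

lemma odd_exponent_derived:
  assumes "odd (m::int)" and m: "\<And>x y. \<lbrakk>x \<in> carrier G; y \<in> carrier G\<rbrakk> \<Longrightarrow> commutator x y [^] m = \<one>"
  shows "odd_exponent (derived_subgroup G)"
proof -
  let ?S = "{z \<in> Z. z [^] m = \<one>}"
  let ?P = "annihilating_exponent (derived_subgroup G)"
  have "subgroup ?S G"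
    by (rule subgroupI)
       (auto simp: int_pow_inv center_int_pow_distrib intro!: exI[of _ \<one>])
  moreover have "derived_set G (carrier G) \<subseteq> ?S"
    using m commutator_center by (auto simp: commutator_def)
  ultimately have S: "derived G (carrier G) \<subseteq> ?S"
    unfolding derived_def by (rule generate_subgroup_incl[rotated])
  define n where "n = nat \<bar>m\<bar>"
  have n: "odd n" using \<open>odd m\<close> by (simp add: n_def even_nat_iff)
  have "z [^] n = \<one>" if "z \<in> derived G (carrier G)" for z
  proof -
    have z: "z \<in> carrier G" "z [^] m = \<one>" using S that by auto
    have "z [^] n = z [^] \<bar>m\<bar>" by (simp add: n_def flip: int_pow_int)
    also have "\<dots> = \<one>" using z by (simp add: abs_if int_pow_neg)
    finally show ?thesis .
  qed
  then have Pn: "?P n" using n by (auto simp: annihilating_exponent_derived_iff intro: Nat.gr0I)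
  define l where "l = group_exponent (derived_subgroup G)"
  have Pl: "?P l" unfolding l_def group_exponent_def by (rule LeastI[of ?P, OF Pn])
  have "n mod l = 0"
  proof (rule ccontr)
    assume "n mod l \<noteq> 0"
    moreover have "z [^] (n mod l) = \<one>" if "z \<in> derived G (carrier G)" for z
    proof -
      have z: "z \<in> carrier G" "z [^] n = \<one>" "z [^] l = \<one>"
        using that Pn Pl derived_closed by (auto simp: annihilating_exponent_derived_iff)
      have "z [^] n = z [^] (l * (n div l) + n mod l)" by simp
      also have "\<dots> = (z [^] l) [^] (n div l) \<otimes> z [^] (n mod l)"
        using z(1) by (simp only: nat_pow_mult[symmetric] nat_pow_pow)
      also have "\<dots> = z [^] (n mod l)" using z by simp
      finally show ?thesis using z by simp
    qed
    ultimately have "?P (n mod l)" by (simp add: annihilating_exponent_derived_iff)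
    then have "l \<le> n mod l" unfolding l_def group_exponent_def by (rule Least_le)
    moreover have "n mod l < l" using Pl by (simp add: annihilating_exponent_def)
    ultimately show False by simp
  qed
  then have "odd l" using n by (meson dvd_trans mod_eq_0_iff_dvd)
  then show ?thesis using Pn by (auto simp: odd_exponent_def finite_exponent_def l_def)
qed

lemma polynomial_reduct_imp_odd_exponent:
  assumes "has_abelian_group_polynomial_reduct G"
  shows "odd_exponent (derived_subgroup G)"
proof -
  obtain H :: "'a monoid" where H: "comm_group H"
    and red: "is_polynomial_reduct (group_algebra H) (group_algebra G)"
    using assms by (auto simp: has_abelian_group_polynomial_reduct_def)
  interpret H: comm_group H by (rule H)
  have carrier: "carrier H = carrier G"
    using red by (simp add: is_polynomial_reduct_def group_algebra_def)
  have "polynomial_operation (group_algebra G) 2 (\<lambda>xs. xs ! 0 \<otimes>\<^bsub>H\<^esub> xs ! 1)"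
    using red by (auto simp: is_polynomial_reduct_def group_algebra_def[of H])
  then obtain t where t: "composed_operation
      (basic_operations (group_algebra G) \<union> constant_operations (carrier G)) 2 t"
    and agree: "agrees_on (carrier G) 2 (\<lambda>xs. xs ! 0 \<otimes>\<^bsub>H\<^esub> xs ! 1) t"
    by (auto simp: polynomial_operation_def group_algebra_def)
  have eq: "t [x, y] = x \<otimes>\<^bsub>H\<^esub> y" if "x \<in> carrier G" "y \<in> carrier G" for x y
    using agree that unfolding agrees_on_def by (auto dest!: spec[of _ "[x, y]"])
  have "\<exists>m::int. odd m \<and> (\<forall>x \<in> carrier G. \<forall>y \<in> carrier G. commutator x y [^] m = \<one>)"
    by (rule commutator_exponent_of_commutative_operation[OF polynomial_normal_form[OF t], of "\<one>\<^bsub>H\<^esub>"])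
       (use H.one_closed H.r_one H.m_comm in \<open>auto simp: eq carrier\<close>)
  then show ?thesis using odd_exponent_derived by blast
qed

section \<open>The abelian group of Baer\<close>

definition baer_group :: "nat \<Rightarrow> 'a monoid" where
  "baer_group j = \<lparr>carrier = carrier G, mult = (\<lambda>x y. x \<otimes> y \<otimes> commutator x y [^] j), one = \<one>\<rparr>"

lemma center_nat_pow_distrib:
  "\<lbrakk>x \<in> Z; y \<in> Z\<rbrakk> \<Longrightarrow> (x \<otimes> y) [^] (k::nat) = x [^] k \<otimes> y [^] k"
  using center_int_pow_distrib[of x y "int k"] by (simp add: int_pow_int)

text \<open>Both bracketings of a triple product are \<open>x y z ([x, y] [x, z] [y, z])\<^sup>j\<close>. Commutativity holds
  because \<open>[x, y]\<^bsup>j+1\<^esup> = [x, y]\<^bsup>-j\<^esup> = [y, x]\<^sup>j\<close>.\<close>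

lemma comm_group_baer_group:
  assumes j: "\<And>x y. \<lbrakk>x \<in> carrier G; y \<in> carrier G\<rbrakk> \<Longrightarrow> commutator x y [^] (2 * j + 1) = \<one>"
  shows "comm_group (baer_group j)"
proof (rule comm_groupI)
  fix x y z
  assume "x \<in> carrier (baer_group j)" "y \<in> carrier (baer_group j)" "z \<in> carrier (baer_group j)"
  then have [simp]: "x \<in> carrier G" "y \<in> carrier G" "z \<in> carrier G" by (auto simp: baer_group_def)
  let ?c = "commutator x y [^] j" and ?d = "commutator y z [^] j"
  have "(x \<otimes> y \<otimes> ?c) \<otimes> z \<otimes> commutator (x \<otimes> y \<otimes> ?c) z [^] j =
      (x \<otimes> y \<otimes> z) \<otimes> (?c \<otimes> (commutator x z [^] j \<otimes> ?d))"
    using factor_center[of "x \<otimes> y" z ?c \<one>]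
    by (simp add: commutator_mult_left commutator_with_center center_nat_pow_distrib m_assoc)
  moreover have "x \<otimes> (y \<otimes> z \<otimes> ?d) \<otimes> commutator x (y \<otimes> z \<otimes> ?d) [^] j =
      (x \<otimes> y \<otimes> z) \<otimes> (?d \<otimes> (?c \<otimes> commutator x z [^] j))"
    by (simp add: commutator_mult_right commutator_with_center center_nat_pow_distrib m_assoc)
  moreover have "?c \<otimes> (commutator x z [^] j \<otimes> ?d) = ?d \<otimes> (?c \<otimes> commutator x z [^] j)"
    by (simp add: center_ac)
  ultimately show "x \<otimes>\<^bsub>baer_group j\<^esub> y \<otimes>\<^bsub>baer_group j\<^esub> z = x \<otimes>\<^bsub>baer_group j\<^esub> (y \<otimes>\<^bsub>baer_group j\<^esub> z)"
    by (simp add: baer_group_def)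
next
  fix x y
  assume "x \<in> carrier (baer_group j)" "y \<in> carrier (baer_group j)"
  then have [simp]: "x \<in> carrier G" "y \<in> carrier G" by (auto simp: baer_group_def)
  let ?c = "commutator x y"
  have "?c \<otimes> ?c [^] j \<otimes> ?c [^] j = ?c [^] (2 * j + 1)"
    by (simp add: nat_pow_mult mult_2 center_ac)
  then have "?c \<otimes> ?c [^] j \<otimes> ?c [^] j = \<one>" using j by simp
  then have "?c \<otimes> ?c [^] j = inv (?c [^] j)" by (intro inv_equality[symmetric]) auto
  then have "x \<otimes> y \<otimes> ?c [^] j = y \<otimes> x \<otimes> inv (?c [^] j)"
    using swap_commutator[of x y] by (simp add: m_assoc)
  then show "x \<otimes>\<^bsub>baer_group j\<^esub> y = y \<otimes>\<^bsub>baer_group j\<^esub> x"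
    by (simp add: baer_group_def commutator_inverse[of x y] nat_pow_inv)
next
  fix x assume "x \<in> carrier (baer_group j)"
  then have x: "x \<in> carrier G" by (simp add: baer_group_def)
  have "commutator (inv x) x = \<one>" using x by (intro commutator_unique) auto
  then show "\<exists>y \<in> carrier (baer_group j). y \<otimes>\<^bsub>baer_group j\<^esub> x = \<one>\<^bsub>baer_group j\<^esub>"
    using x by (intro bexI[of _ "inv x"]) (auto simp: baer_group_def)
qed (auto simp: baer_group_def commutator_with_center)

lemma inv_baer_group:
  assumes "comm_group (baer_group j)" "x \<in> carrier G"
  shows "inv\<^bsub>baer_group j\<^esub> x = inv x"
proof -
  interpret B: comm_group "baer_group j" by (rule assms)
  have "commutator (inv x) x = \<one>" using assms by (intro commutator_unique) auto
  then show ?thesis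
    using assms by (intro B.inv_equality) (auto simp: baer_group_def)
qed

lemma composed_operation_group:
  fixes n :: nat
  defines "T \<equiv> composed_operation (basic_operations (group_algebra G)) n"
  shows composed_operation_one: "T (\<lambda>xs. \<one>)"
    and composed_operation_inv: "T f \<Longrightarrow> T (\<lambda>xs. inv (f xs))"
    and composed_operation_mult: "\<lbrakk>T f; T g\<rbrakk> \<Longrightarrow> T (\<lambda>xs. f xs \<otimes> g xs)"
proof -
  let ?F = "basic_operations (group_algebra G)"
  show "T (\<lambda>xs. \<one>)"
    using composed_operation.composition[of 0 "\<lambda>_. \<one>" ?F "[]" n]
    by (simp add: T_def group_algebra_def)
  show "T (\<lambda>xs. inv (f xs))" if "T f"
    using composed_operation.composition[of 1 "\<lambda>xs. inv (xs ! 0)" ?F "[f]" n] that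
    by (simp add: T_def group_algebra_def)
  show "T (\<lambda>xs. f xs \<otimes> g xs)" if "T f" "T g"
    using composed_operation.composition[of 2 "\<lambda>xs. xs ! 0 \<otimes> xs ! 1" ?F "[f, g]" n] that
    by (auto simp: T_def group_algebra_def)
qed

lemma composed_operation_nat_pow:
  "composed_operation (basic_operations (group_algebra G)) n f \<Longrightarrow>
   composed_operation (basic_operations (group_algebra G)) n (\<lambda>xs. f xs [^] (k::nat))"
  by (induction k) (simp_all add: composed_operation_one composed_operation_mult)

lemma odd_exponent_imp_reduct:
  assumes "odd_exponent (derived_subgroup G)"
  shows "has_abelian_group_reduct G"
proof -
  let ?T = "composed_operation (basic_operations (group_algebra G))"
  define n where "n = group_exponent (derived_subgroup G)"
  have "odd n" using assms by (simp add: odd_exponent_def n_def)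
  then obtain j where j: "n = 2 * j + 1" by (rule oddE)
  have "annihilating_exponent (derived_subgroup G) n"
    using assms unfolding odd_exponent_def finite_exponent_def n_def group_exponent_def
    by (metis LeastI)
  then have "\<forall>z \<in> derived G (carrier G). z [^] n = \<one>"
    by (simp add: annihilating_exponent_derived_iff)
  moreover have "commutator x y \<in> derived G (carrier G)" if "x \<in> carrier G" "y \<in> carrier G" for x y
    using that unfolding derived_def commutator_def by (blast intro: generate.incl)
  ultimately have B: "comm_group (baer_group j)"
    unfolding j by (intro comm_group_baer_group) blast
  have "?T 2 (\<lambda>xs. xs ! 0 \<otimes> xs ! 1 \<otimes> commutator (xs ! 0) (xs ! 1) [^] j)"
    unfolding commutator_def
    by (intro composed_operation_mult composed_operation_nat_pow composed_operation_inv
        composed_operation.projection) auto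
  then have "term_operation (group_algebra G) 2 (\<lambda>xs. xs ! 0 \<otimes>\<^bsub>baer_group j\<^esub> xs ! 1)"
    by (auto simp: term_operation_def agrees_on_def baer_group_def)
  moreover have "?T 1 (\<lambda>xs. inv (xs ! 0))"
    by (intro composed_operation_inv composed_operation.projection) auto
  then have "term_operation (group_algebra G) 1 (\<lambda>xs. inv\<^bsub>baer_group j\<^esub> (xs ! 0))"
    unfolding term_operation_def agrees_on_def
    by (intro exI[of _ "\<lambda>xs. inv (xs ! 0)"] conjI)
       (auto simp: group_algebra_def inv_baer_group[OF B] length_Suc_conv)
  moreover have "term_operation (group_algebra G) 0 (\<lambda>_. \<one>\<^bsub>baer_group j\<^esub>)"
    using composed_operation_one by (auto simp: term_operation_def agrees_on_def baer_group_def)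
  ultimately have "is_reduct (group_algebra (baer_group j)) (group_algebra G)"
    by (simp add: is_reduct_def group_algebra_def[of "baer_group j"])
       (simp add: group_algebra_def baer_group_def)
  then show ?thesis using B by (auto simp: has_abelian_group_reduct_def)
qed

end

section \<open>Term and polynomial reducts\<close>

lemma composed_operation_mono:
  assumes "composed_operation F n t" "F \<subseteq> F'"
  shows "composed_operation F' n t"
  using assms(1)
proof induction
  case (composition m f gs)
  then show ?case using assms(2) by (intro composed_operation.composition[of m]) auto
qed (rule composed_operation.projection)

lemma reduct_imp_polynomial_reduct:
  assumes "has_abelian_group_reduct G"
  shows "has_abelian_group_polynomial_reduct G"
proof -
  have "polynomial_operation \<A> n f" if "term_operation \<A> n f" for \<A> :: "'a univ_algebra" and n f
    using that composed_operation_mono[OF _ Un_upper1]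
    unfolding term_operation_def polynomial_operation_def by blast
  then show ?thesis
    using assms
    unfolding has_abelian_group_reduct_def has_abelian_group_polynomial_reduct_def
      is_reduct_def is_polynomial_reduct_def by blast
qed

theorem corollary4p3:
  fixes G :: "('a, 'b) monoid_scheme"
  assumes "group G" and "two_nilpotent G"
  shows "(has_abelian_group_reduct G \<longleftrightarrow> odd_exponent (derived_subgroup G)) \<and>
         (has_abelian_group_polynomial_reduct G \<longleftrightarrow> odd_exponent (derived_subgroup G))"
proof -
  interpret two_nilpotent_group G
    using assms by (simp add: two_nilpotent_group_def two_nilpotent_group_axioms_def)
  show ?thesis
    using odd_exponent_imp_reduct reduct_imp_polynomial_reduct[of G]
      polynomial_reduct_imp_odd_exponent by blast
qed

end
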